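(* Let $X=(X,d,\mu)$ be a metric measure space satisfying the standing assumptions of the context (in particular $\mu$ is doubling). Let $0<s<1$, $1<t<\infty$ and $\lambda\ge1$. Assume that $E\subset X$ is a (nonempty) closed set for which there is a constant $C>0$ such that \[ \int_{B\setminus E}\frac{|u(x)|^t}{d(x,E)^{st}}\,d\mu(x)\le C\int_{\lambda B}\int_{\lambda B}\frac{|u(x)-u(y)|^t}{d(x,y)^{st}\mu(B(x,d(x,y)))}\,d\mu(y)\,d\mu(x) \] whenever $u\colon X\to\mathbb R$ is a bounded continuous function such that $u=0$ on $E$, and $B=B(w,r)$ with $w\in E$ and $0<r<\operatorname{diam}(E)$. Then $\overline{\operatorname{co\,dim}}_A(E)\le st$.
   Context: Standing assumptions: $X=(X,d,\mu)$ is a metric measure space with at least two points, where $\mu$ is a Borel measure supported on $X$ such that $\mu(\{x\})=0$ for all $x\in X$ and $0<\mu(B)<\infty$ for all open balls $B=B(x,r)=\{y\in X: d(x,y)<r\}$, $x\in X$, $r>0$. Each ball has a fixed center and radius, and $\lambda B(x,r)=B(x,\lambda r)$. The measure $\mu$ is doubling: there is $c_D\ge1$ such that $\mu(B(x,2r))\le c_D\,\mu(B(x,r))$ for all $x\in X$, $r>0$. Here $d(x,E)=\operatorname{dist}(x,E)$ is the distance from $x$ to $E$, and $\operatorname{diam}(E)$ is the diameter of $E$. Upper Assouad codimension: for $E\subset X$ and $r>0$ let $E_r=\{x\in X:\operatorname{dist}(x,E)<r\}$. Then $\overline{\operatorname{co\,dim}}_A(E)$ is the infimum of all $Q\ge0$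 for which there is a constant $c>0$ such that \[ \frac{\mu(E_r\cap B(x,R))}{\mu(B(x,R))}\ge c\Bigl(\frac rR\Bigr)^Q \] for every $x\in E$ and all $0<r<R<\operatorname{diam}(E)$. If $E$ consists of one point, then the restriction $R<\operatorname{diam}(E)$ in this definition is removed.
   Formalization: If E is a single point, the integral inequality is assumed for all radii r>0 rather than 0<r<diam(E)=0; read literally the assumption is then empty and the claim fails (X the real line, E={0}, s=1/2, t=3/2: codimension 1 > 3/4). *)

theory Defs
  imports "HOL-Analysis.Analysis"
begin

text \<open>
  The space $X$ is the whole type. That \<open>M\<close> is supported on $X$ is contained in the positivity
  of the measure of every ball.
\<close>
locale doubling_metric_measure_space =
  fixes M :: "'a::metric_space measure"
  assumes two_points: "\<exists>x y :: 'a. x \<noteq> y"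
    and sets_M: "sets M = sets borel"
    and emeasure_point: "emeasure M {x} = 0"
    and emeasure_ball_pos: "r > 0 \<Longrightarrow> 0 < emeasure M (ball x r)"
    and emeasure_ball_finite: "r > 0 \<Longrightarrow> emeasure M (ball x r) < \<infinity>"
    and doubling: "\<exists>c\<ge>1. \<forall>x. \<forall>r>0. measure M (ball x (2 * r)) \<le> c * measure M (ball x r)"

text \<open>The library's \<^const>\<open>diameter\<close> is real-valued and only meaningful for bounded sets.\<close>
definition ediameter :: "'a::metric_space set \<Rightarrow> ereal" where
  "ediameter E = (if bounded E then ereal (diameter E) else \<infinity>)"

text \<open>
  The restriction $0 < R < \mathrm{diam}(E)$, with the convention that the upper bound is dropped
  when \<open>E\<close> consists of one point.
\<close>
definition admissible_radius :: "'a::metric_space set \<Rightarrow> real \<Rightarrow> bool" where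
  "admissible_radius E R \<longleftrightarrow> 0 < R \<and> (is_singleton E \<or> ereal R < ediameter E)"

definition open_nbhd :: "'a::metric_space set \<Rightarrow> real \<Rightarrow> 'a set" where
  "open_nbhd E r = {x. infdist x E < r}"

text \<open>
  The infimum is taken in the extended reals, so that it is \<open>\<infinity>\<close> if there is no admissible exponent.
\<close>
definition upper_assouad_codim :: "'a::metric_space measure \<Rightarrow> 'a set \<Rightarrow> ereal" where
  "upper_assouad_codim M E =
     Inf (ereal ` {Q. Q \<ge> 0 \<and>
       (\<exists>c>0. \<forall>x\<in>E. \<forall>r R. 0 < r \<and> r < R \<and> admissible_radius E R \<longrightarrow>
          measure M (open_nbhd E r \<inter> ball x R) / measure M (ball x R) \<ge> c * (r / R) powr Q)})"

end

theory Submission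
  imports Defs
begin

text \<open>
  Let $p = st$ and test the inequality on $B' = B(w, R/\Lambda)$ with
  $u = \min\{1, d(\cdot, E)/r\}$. Since $u = 1$ off $E_r$ and $d(\cdot, E) \le R/\Lambda$ on $B'$,
  the left-hand side is at least $(R/\Lambda)^{-p} \mu(B' \setminus E_r)$. On the right-hand side only pairs
  with $x \in E_r$ or $y \in E_r$ contribute, and $|u(x) - u(y)| \le \min\{1, d(x,y)/r\}$; since
  $0 < p < t$, summing over dyadic annuli and using Tonelli's theorem for the pairs with $y \in E_r$
  bounds it by a constant times $r^{-p} \mu(E_r \cap B(w,R))$. Together with
  $\mu(B') = \mu(B' \setminus E_r) + \mu(B' \cap E_r)$ and $(R/r)^p \ge 1$ this gives
  $\mu(B(w,R)) \le c\,(R/r)^p \mu(E_r \cap B(w,R))$, so the exponent $p$ itself is admissible in the definition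
  of the codimension.
\<close>

section \<open>Dyadic scales, maximal separated sets and truncated powers\<close>

lemma ex_dyadic_interval:
  fixes x :: real
  assumes "1 \<le> x"
  shows "\<exists>n. 2 ^ n \<le> x \<and> x \<le> 2 ^ Suc n"
proof -
  obtain N :: nat where N: "x < 2 ^ N"
    using real_arch_pow[of 2 x] by auto
  define m where "m = (LEAST n::nat. x < 2 ^ n)"
  have m: "x < 2 ^ m"
    unfolding m_def using N by (rule LeastI)
  have "m \<noteq> 0"
    using m assms by (cases m) auto
  then obtain n where n: "m = Suc n"
    by (cases m) auto
  have "\<not> x < 2 ^ n"
    using not_less_Least[of n "\<lambda>n. x < 2 ^ n"] n m_def by auto
  then show ?thesis
    using m n by (intro exI[of _ n]) auto
qed

text \<open>Zorn's lemma gives an \<open>e\<close>-separated set that is maximal under inclusion. A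
  point at distance at least \<open>e\<close> from all its members could be added to it, so
  maximality makes it an \<open>e\<close>-net.\<close>

lemma ex_maximal_separated:
  fixes e :: real
  assumes "0 < e"
  shows "\<exists>D :: 'a::metric_space set. (\<forall>x\<in>D. \<forall>y\<in>D. x \<noteq> y \<longrightarrow> e \<le> dist x y) \<and> (\<forall>x. \<exists>d\<in>D. dist d x < e)"
proof -
  define A where "A = {D :: 'a set. \<forall>x\<in>D. \<forall>y\<in>D. x \<noteq> y \<longrightarrow> e \<le> dist x y}"
  have "\<exists>D\<in>A. \<forall>X\<in>A. D \<subseteq> X \<longrightarrow> X = D"
  proof (rule subset_Zorn')
    fix c assume c: "subset.chain A c"
    show "\<Union>c \<in> A"
      unfolding A_def
    proof (intro CollectI ballI impI)
      fix x y assume "x \<in> \<Union>c" "y \<in> \<Union>c" "x \<noteq> y"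
      then obtain X where "X \<in> c" "x \<in> X" "y \<in> X"
        using c unfolding subset.chain_def by blast
      moreover have "X \<in> A"
        using c \<open>X \<in> c\<close> unfolding subset.chain_def by blast
      ultimately show "e \<le> dist x y"
        using \<open>x \<noteq> y\<close> by (auto simp: A_def)
    qed
  qed
  then obtain D where D: "D \<in> A" and max: "\<And>X. X \<in> A \<Longrightarrow> D \<subseteq> X \<Longrightarrow> X = D"
    by blast
  have "\<exists>d\<in>D. dist d x < e" for x
  proof (rule ccontr)
    assume "\<not> ?thesis"
    then have far: "\<And>d. d \<in> D \<Longrightarrow> e \<le> dist d x" by force
    then have "insert x D \<in> A"
      using D by (auto simp: A_def dist_commute)
    from max[OF this] have "x \<in> D" by auto
    from far[OF this] show False using assms by simp
  qed
  then show ?thesis using D unfolding A_def by blast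
qed

text \<open>Here \<open>m\<close> stands for the ratio of the distance to the scale
  \<open>r\<close>, lying at least \<open>n\<close> dyadic steps above or below 1. The left side is
  \<open>m powr (- p)\<close> for large \<open>m\<close> and \<open>m powr (t - p)\<close> for small
  \<open>m\<close>; since \<open>0 < p < t\<close>, both decay geometrically in \<open>n\<close>,
  and the smaller of the two exponents serves for both ranges.\<close>

lemma truncated_ratio_powr_le:
  fixes p t m :: real and n :: nat
  assumes "0 < p" "p < t" "0 < m" and m: "2 ^ n \<le> m \<or> m \<le> 1 / 2 ^ n"
  shows "min 1 m powr t * m powr (- p) \<le> (2 powr (- min p (t - p))) ^ n"
proof -
  have pow: "(2 powr (- a)) ^ n = ((2::real) ^ n) powr (- a)" for a :: real
    by (simp add: powr_realpow[symmetric] powr_powr mult.commute)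
  from m show ?thesis
  proof
    assume m: "2 ^ n \<le> m"
    then have "1 \<le> m"
      using one_le_power[of "2::real" n] by linarith
    then have "min 1 m powr t * m powr (- p) = m powr (- p)" by simp
    also have "\<dots> \<le> (2 ^ n) powr (- p)"
      using m assms by (intro powr_mono2') auto
    also have "\<dots> \<le> (2 ^ n) powr (- min p (t - p))"
      by (intro powr_mono) auto
    finally show ?thesis by (simp only: pow)
  next
    assume m: "m \<le> 1 / 2 ^ n"
    then have "m \<le> 1"
      using one_le_power[of "2::real" n] by (smt (verit) divide_le_eq_1)
    then have "min 1 m powr t * m powr (- p) = m powr (t - p)"
      by (simp add: powr_add[symmetric])
    also have "\<dots> \<le> (1 / 2 ^ n) powr (t - p)"
      using m assms by (intro powr_mono2) auto
    also have "\<dots> = (2 ^ n) powr (- (t - p))"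
      by (simp add: powr_divide powr_minus_divide del: minus_diff_eq)
    also have "\<dots> \<le> (2 ^ n) powr (- min p (t - p))"
      by (intro powr_mono) auto
    finally show ?thesis by (simp only: pow)
  qed
qed

section \<open>Finiteness of the measure on bounded sets\<close>

context doubling_metric_measure_space
begin

lemma sets_M_eq_borel [measurable_cong]: "sets M = sets borel"
  by (rule sets_M)

lemma space_M [simp]: "space M = UNIV"
  using sets_eq_imp_space_eq[OF sets_M] by simp

lemma emeasure_ball_eq_measure: "0 < r \<Longrightarrow> emeasure M (ball x r) = ennreal (measure M (ball x r))"
  using emeasure_ball_finite[of r x] by (simp add: emeasure_eq_ennreal_measure top.not_eq_extremum)

lemma measure_ball_pos: "0 < r \<Longrightarrow> 0 < measure M (ball x r)"
  using emeasure_ball_pos[of r x] emeasure_ball_eq_measure[of r x] by simp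

text \<open>The function \<open>measure\<close> is monotone only where the larger set has finite
  measure; the enclosing ball provides this.\<close>

lemma measure_mono_subset_ball:
  assumes "A \<subseteq> B" "B \<subseteq> ball x r" "0 < r" "A \<in> sets borel" "B \<in> sets borel"
  shows "measure M A \<le> measure M B"
proof (rule measure_mono_fmeasurable)
  have "emeasure M B \<le> emeasure M (ball x r)"
    using assms by (intro emeasure_mono) (auto simp: sets_M)
  also have "\<dots> < \<infinity>" using assms by (rule_tac emeasure_ball_finite)
  finally show "B \<in> fmeasurable M"
    using assms by (auto simp: fmeasurable_def sets_M)
qed (use assms in \<open>auto simp: sets_M\<close>)

lemma emeasure_subset_ball_eq_measure:
  assumes "A \<subseteq> ball x r" "0 < r" "A \<in> sets borel"
  shows "emeasure M A = ennreal (measure M A)"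
proof -
  have "emeasure M A \<le> emeasure M (ball x r)"
    using assms by (intro emeasure_mono) (auto simp: sets_M)
  also have "\<dots> < \<infinity>" using assms by (rule_tac emeasure_ball_finite)
  finally show ?thesis
    by (simp add: emeasure_eq_ennreal_measure top.not_eq_extremum)
qed

lemma sigma_finite_measure_M: "sigma_finite_measure M"
proof
  let ?x = "undefined :: 'a"
  let ?A = "range (\<lambda>n::nat. ball ?x (real (Suc n)))"
  have "\<Union>?A = UNIV"
  proof safe
    fix y :: 'a
    obtain n where "dist ?x y < real n" using reals_Archimedean2 by blast
    then show "y \<in> \<Union>?A" by (intro UnionI[of "ball ?x (real (Suc n))"]) auto
  qed auto
  moreover have "emeasure M a \<noteq> \<infinity>" if "a \<in> ?A" for a
    using that emeasure_ball_eq_measure by auto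
  ultimately show "\<exists>A. countable A \<and> A \<subseteq> sets M \<and> \<Union>A = space M \<and> (\<forall>a\<in>A. emeasure M a \<noteq> \<infinity>)"
    by (intro exI[of _ ?A]) (auto simp: sets_M)
qed

section \<open>Separability and joint measurability of the distance\<close>

text \<open>The balls of radius \<open>e / 2\<close> about the points of \<open>D\<close> are
  pairwise disjoint and have positive measure. Only finitely many of those with centres in a bounded
  region can have measure above \<open>1 / n\<close>, because they all lie in one ball of finite
  measure. Letting the region and \<open>n\<close> grow exhausts \<open>D\<close> by the finite sets
  \<open>T m n\<close>.\<close>

lemma countable_separated:
  fixes D :: "'a set"
  assumes "0 < e" and sep: "\<And>x y. x \<in> D \<Longrightarrow> y \<in> D \<Longrightarrow> x \<noteq> y \<Longrightarrow> e \<le> dist x y"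
  shows "countable D"
proof -
  let ?o = "undefined :: 'a"
  define T where "T m n = {z \<in> D. dist ?o z < real m \<and> 1 < real n * measure M (ball z (e / 2))}" for m n
  have "finite (T m n)" for m n
  proof -
    let ?B = "ball ?o (real m + e)"
    have "finite (T m n) \<and> card (T m n) \<le> nat \<lceil>real n * measure M ?B\<rceil>"
    proof (rule finite_if_finite_subsets_card_bdd)
      fix F assume F: "F \<subseteq> T m n" "finite F"
      let ?U = "\<Union>z\<in>F. ball z (e / 2)"
      have disj: "disjoint_family_on (\<lambda>z. ball z (e / 2)) F"
        unfolding disjoint_family_on_def
      proof (intro ballI impI, rule ccontr)
        fix x y assume "x \<in> F" "y \<in> F" "x \<noteq> y" and "ball x (e / 2) \<inter> ball y (e / 2) \<noteq> {}"
        then obtain z where "dist x z < e / 2" "dist y z < e / 2" by auto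
        then have "dist x y < e"
          using dist_triangle2[of x y z] by simp
        moreover have "e \<le> dist x y"
          using \<open>x \<in> F\<close> \<open>y \<in> F\<close> \<open>x \<noteq> y\<close> F sep by (auto simp: T_def)
        ultimately show False by simp
      qed
      have sub: "?U \<subseteq> ?B"
      proof safe
        fix z y assume "z \<in> F" "y \<in> ball z (e / 2)"
        then have "dist ?o z < real m" "dist z y < e / 2" using F by (auto simp: T_def)
        then show "y \<in> ?B"
          using dist_triangle[of ?o y z] \<open>0 < e\<close> by simp
      qed
      have "real (card F) = (\<Sum>z\<in>F. 1)" by simp
      also have "\<dots> \<le> (\<Sum>z\<in>F. real n * measure M (ball z (e / 2)))"
        using F by (intro sum_mono) (force simp: T_def)
      also have "\<dots> = real n * measure M ?U"
        using F \<open>0 < e\<close> emeasure_ball_eq_measure disj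
        by (subst measure_finite_Union) (auto simp: sum_distrib_left sets_M)
      also have "\<dots> \<le> real n * measure M ?B"
        using sub \<open>0 < e\<close> by (intro mult_left_mono measure_mono_subset_ball[of _ _ ?o "real m + e"] borel_open) auto
      finally show "card F \<le> nat \<lceil>real n * measure M ?B\<rceil>"
        by linarith
    qed
    then show ?thesis ..
  qed
  moreover have "D \<subseteq> (\<Union>m n. T m n)"
  proof
    fix z assume "z \<in> D"
    obtain m where "dist ?o z < real m" using reals_Archimedean2 by blast
    moreover obtain n where "1 < real n * measure M (ball z (e / 2))"
      using ex_less_of_nat_mult[of "measure M (ball z (e / 2))" 1] measure_ball_pos[of "e / 2" z] \<open>0 < e\<close> by auto
    ultimately show "z \<in> (\<Union>m n. T m n)"
      using \<open>z \<in> D\<close> by (auto simp: T_def)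
  qed
  ultimately show ?thesis
    by (meson countable_UN countable_finite countable_subset uncountable_def countableI_type)
qed

text \<open>
  The library's measurability of \<^const>\<open>dist\<close> needs a second countable type; here separability
  comes from the finiteness and positivity of the measure of balls.
\<close>
lemma borel_measurable_dist_pair [measurable]:
  "(\<lambda>z. dist (fst z) (snd z)) \<in> borel_measurable (M \<Otimes>\<^sub>M M)"
proof (subst borel_measurable_iff_less, intro allI)
  fix a :: real
  \<comment> \<open>A maximal separated set at scale \<open>1 / Suc n\<close> is both countable and
    a net at that scale.\<close>
  have "\<forall>n::nat. \<exists>D::'a set. countable D \<and> (\<forall>x. \<exists>d\<in>D. dist d x < 1 / real (Suc n))"
  proof
    fix n :: nat
    obtain D :: "'a set" where
      "\<forall>x\<in>D. \<forall>y\<in>D. x \<noteq> y \<longrightarrow> 1 / real (Suc n) \<le> dist x y" "\<forall>x. \<exists>d\<in>D. dist d x < 1 / real (Suc n)"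
      using ex_maximal_separated[of "1 / real (Suc n)"] by auto
    then show "\<exists>D::'a set. countable D \<and> (\<forall>x. \<exists>d\<in>D. dist d x < 1 / real (Suc n))"
      using countable_separated[of "1 / real (Suc n)" D] by auto
  qed
  then obtain D :: "nat \<Rightarrow> 'a set" where D: "\<And>n. countable (D n)"
      "\<And>n x. \<exists>d\<in>D n. dist d x < 1 / real (Suc n)"
    by metis
  \<comment> \<open>The open strip around the diagonal is a countable union of products of balls:
    both points are compared with a net point \<open>d\<close> close to the first one.\<close>
  have "{z \<in> space (M \<Otimes>\<^sub>M M). dist (fst z) (snd z) < a} =
      (\<Union>n. \<Union>d\<in>D n. ball d (1 / real (Suc n)) \<times> ball d (a - 1 / real (Suc n)))" (is "?L = ?R")
  proof (rule set_eqI, rule iffI)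
    fix z assume "z \<in> ?L"
    moreover obtain x y where z: "z = (x, y)" by (cases z)
    \<comment> \<open>The gap is halved because \<open>1 / Suc n\<close> is spent twice: in moving
      from \<open>x\<close> to \<open>d\<close>, and in the reduced radius of the second
      ball.\<close>
    ultimately have "0 < (a - dist x y) / 2" by simp
    then obtain n where "inverse (real (Suc n)) < (a - dist x y) / 2"
      using reals_Archimedean by blast
    then have n: "dist x y + 2 * (1 / real (Suc n)) < a"
      by (simp add: inverse_eq_divide)
    obtain d where d: "d \<in> D n" "dist d x < 1 / real (Suc n)" using D by blast
    have "dist d y \<le> dist d x + dist x y" by (rule dist_triangle)
    with n d have "dist d y < a - 1 / real (Suc n)" by linarith
    with d have "z \<in> ball d (1 / real (Suc n)) \<times> ball d (a - 1 / real (Suc n))"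
      by (simp add: z)
    with d show "z \<in> ?R" by blast
  next
    fix z assume "z \<in> ?R"
    then obtain n d where "z \<in> ball d (1 / real (Suc n)) \<times> ball d (a - 1 / real (Suc n))" by blast
    moreover obtain x y where z: "z = (x, y)" by (cases z)
    ultimately have "dist d x < 1 / real (Suc n)" "dist d y < a - 1 / real (Suc n)" by auto
    then have "dist x y < a"
      using dist_triangle2[of x y d] dist_triangle[of x y d] by (simp add: dist_commute)
    then show "z \<in> ?L" by (simp add: z space_pair_measure)
  qed
  also have "\<dots> \<in> sets (M \<Otimes>\<^sub>M M)"
    using D(1) by (intro sets.countable_UN' sets.countable_UN) (auto simp: sets_M)
  finally show "{z \<in> space (M \<Otimes>\<^sub>M M). dist (fst z) (snd z) < a} \<in> sets (M \<Otimes>\<^sub>M M)" .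
qed

text \<open>The ball is the section at \<open>x\<close> of the measurable set of pairs at distance
  less than \<open>r\<close>, and sigma-finiteness makes the measure of sections measurable.\<close>

lemma borel_measurable_measure_ball [measurable]: "(\<lambda>x. measure M (ball x r)) \<in> borel_measurable M"
proof -
  interpret sigma_finite_measure M by (rule sigma_finite_measure_M)
  have "{z \<in> space (M \<Otimes>\<^sub>M M). dist (fst z) (snd z) < r} \<in> sets (M \<Otimes>\<^sub>M M)"
    by measurable
  from measurable_emeasure_Pair[OF this]
  have "(\<lambda>x. emeasure M (ball x r)) \<in> borel_measurable M"
    by (simp add: space_pair_measure vimage_def ball_def)
  then show ?thesis unfolding measure_def by measurable
qed

section \<open>Consequences of the doubling condition\<close>

text \<open>One doubling constant is fixed once and for all, so that later bounds can carry explicit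
  constants.\<close>

definition doubling_const :: real where
  "doubling_const = (SOME c. 1 \<le> c \<and> (\<forall>x. \<forall>r>0. measure M (ball x (2 * r)) \<le> c * measure M (ball x r)))"

lemma doubling_const_ge_1: "1 \<le> doubling_const"
  and measure_ball_double: "0 < r \<Longrightarrow> measure M (ball x (2 * r)) \<le> doubling_const * measure M (ball x r)"
proof -
  have "1 \<le> doubling_const \<and> (\<forall>x. \<forall>r>0. measure M (ball x (2 * r)) \<le> doubling_const * measure M (ball x r))"
    unfolding doubling_const_def by (rule someI_ex) (rule doubling)
  then show "1 \<le> doubling_const"
    "0 < r \<Longrightarrow> measure M (ball x (2 * r)) \<le> doubling_const * measure M (ball x r)" by auto
qed

lemma measure_ball_power2:
  assumes "0 < r"
  shows "measure M (ball x (2 ^ n * r)) \<le> doubling_const ^ n * measure M (ball x r)"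
proof (induction n)
  case (Suc n)
  have "measure M (ball x (2 ^ Suc n * r)) = measure M (ball x (2 * (2 ^ n * r)))"
    by (simp add: mult.assoc)
  also have "\<dots> \<le> doubling_const * measure M (ball x (2 ^ n * r))"
    using assms by (intro measure_ball_double) auto
  also have "\<dots> \<le> doubling_const * (doubling_const ^ n * measure M (ball x r))"
    using Suc doubling_const_ge_1 by (intro mult_left_mono) auto
  finally show ?case by (simp add: mult.assoc)
qed simp

text \<open>With \<open>d = dist x y\<close>, the ball \<open>ball y d\<close> lies in
  \<open>ball x (2 * d)\<close>. Thus the kernel of the double integral, which is asymmetric only
  through its measure factor, is symmetric up to a factor \<open>doubling_const\<close>.\<close>

lemma measure_ball_swap:
  assumes "x \<noteq> y"
  shows "measure M (ball y (dist x y)) \<le> doubling_const * measure M (ball x (dist x y))"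
proof -
  have "ball y (dist x y) \<subseteq> ball x (2 * dist x y)"
  proof
    fix z assume "z \<in> ball y (dist x y)"
    then show "z \<in> ball x (2 * dist x y)"
      using dist_triangle[of x z y] by simp
  qed
  then have "measure M (ball y (dist x y)) \<le> measure M (ball x (2 * dist x y))"
    using assms by (intro measure_mono_subset_ball[of _ _ x "2 * dist x y"]) auto
  also have "\<dots> \<le> doubling_const * measure M (ball x (dist x y))"
    using assms by (intro measure_ball_double) simp
  finally show ?thesis .
qed

section \<open>Dyadic kernels dominating the fractional kernel\<close>

text \<open>The radius in the measure factor is frozen at the inner radius \<rho> instead of being
  \<open>dist x y\<close>. This gives an upper bound on the annulus and reduces joint measurability
  to that of the distance and of the measure of balls of fixed radius.\<close>

definition annulus_kernel :: "real \<Rightarrow> 'a \<Rightarrow> 'a \<Rightarrow> ennreal" where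
  "annulus_kernel \<rho> x y = ennreal (indicator {\<rho>..2 * \<rho>} (dist x y) / measure M (ball x \<rho>))"

lemma borel_measurable_annulus_kernel:
  assumes [measurable]: "f \<in> measurable N M" "g \<in> measurable N M"
  shows "(\<lambda>z. annulus_kernel \<rho> (f z) (g z)) \<in> borel_measurable N"
proof -
  have "(\<lambda>z. dist (fst (f z, g z)) (snd (f z, g z))) \<in> borel_measurable N"
    by (rule measurable_compose[OF _ borel_measurable_dist_pair]) measurable
  then have [measurable]: "(\<lambda>z. dist (f z) (g z)) \<in> borel_measurable N"
    by simp
  show ?thesis
    unfolding annulus_kernel_def by measurable
qed

text \<open>The annulus is closed at radius \<open>2 * \<rho>\<close>, hence it is put into the open
  ball of radius \<open>4 * \<rho>\<close>, which costs two doublings.\<close>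

lemma nn_integral_annulus_kernel_le:
  assumes "0 < \<rho>"
  shows "(\<integral>\<^sup>+y. annulus_kernel \<rho> x y \<partial>M) \<le> ennreal (doubling_const\<^sup>2)"
proof -
  have pos: "0 < measure M (ball x \<rho>)" using assms by (rule measure_ball_pos)
  have "(\<integral>\<^sup>+y. annulus_kernel \<rho> x y \<partial>M)
      \<le> (\<integral>\<^sup>+y. ennreal (1 / measure M (ball x \<rho>)) * indicator (ball x (2 ^ 2 * \<rho>)) y \<partial>M)"
    using assms by (intro nn_integral_mono) (auto simp: annulus_kernel_def indicator_def)
  also have "\<dots> = ennreal (1 / measure M (ball x \<rho>)) * ennreal (measure M (ball x (2 ^ 2 * \<rho>)))"
    using assms by (subst nn_integral_cmult_indicator) (auto simp: sets_M emeasure_ball_eq_measure)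
  also have "\<dots> = ennreal (measure M (ball x (2 ^ 2 * \<rho>)) / measure M (ball x \<rho>))"
    by (subst ennreal_mult[symmetric]) auto
  also have "\<dots> \<le> ennreal (doubling_const\<^sup>2)"
    using measure_ball_power2[OF assms, of x 2] pos by (intro ennreal_leI) (simp add: divide_le_eq)
  finally show ?thesis .
qed

text \<open>The annuli start at \<open>r * 2 ^ n\<close> outwards and at
  \<open>r / 2 ^ Suc n\<close> inwards, so for positive \<open>r\<close> they meet at
  \<open>r\<close> and cover all positive distances; the weight \<open>q ^ n\<close> records the
  number of dyadic steps away from \<open>r\<close>.\<close>

definition dyadic_kernel :: "real \<Rightarrow> real \<Rightarrow> 'a \<Rightarrow> 'a \<Rightarrow> ennreal" where
  "dyadic_kernel q r x y =
     (\<Sum>n. ennreal (q ^ n) * (annulus_kernel (r * 2 ^ n) x y + annulus_kernel (r / 2 ^ Suc n) x y))"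

lemma borel_measurable_dyadic_kernel:
  assumes "f \<in> measurable N M" "g \<in> measurable N M"
  shows "(\<lambda>z. dyadic_kernel q r (f z) (g z)) \<in> borel_measurable N"
proof -
  have [measurable]: "(\<lambda>z. annulus_kernel \<rho> (f z) (g z)) \<in> borel_measurable N" for \<rho>
    by (intro borel_measurable_annulus_kernel assms)
  show ?thesis
    unfolding dyadic_kernel_def by measurable
qed

text \<open>Each index contributes two annuli of mass at most \<open>doubling_const\<^sup>2\<close>,
  and the weights form a geometric series. The bound depends neither on \<open>x\<close> nor on
  \<open>r\<close>.\<close>

lemma nn_integral_dyadic_kernel_le:
  assumes "0 < r" "0 < q" "q < 1"
  shows "(\<integral>\<^sup>+y. dyadic_kernel q r x y \<partial>M) \<le> ennreal (2 * doubling_const\<^sup>2 / (1 - q))"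
proof -
  have [measurable]: "annulus_kernel \<rho> x \<in> borel_measurable M" for \<rho>
    by (rule borel_measurable_annulus_kernel) auto
  have "(\<integral>\<^sup>+y. dyadic_kernel q r x y \<partial>M) =
      (\<Sum>n. ennreal (q ^ n) * ((\<integral>\<^sup>+y. annulus_kernel (r * 2 ^ n) x y \<partial>M) + (\<integral>\<^sup>+y. annulus_kernel (r / 2 ^ Suc n) x y \<partial>M)))"
    unfolding dyadic_kernel_def
    by (subst nn_integral_suminf) (auto simp: nn_integral_cmult nn_integral_add)
  also have "\<dots> \<le> (\<Sum>n. ennreal (q ^ n) * (ennreal (doubling_const\<^sup>2) + ennreal (doubling_const\<^sup>2)))"
    using assms by (intro suminf_le mult_left_mono add_mono nn_integral_annulus_kernel_le) auto
  also have "\<dots> = (\<Sum>n. ennreal (q ^ n)) * ennreal (2 * doubling_const\<^sup>2)"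
    by (subst ennreal_suminf_multc[symmetric]) (simp flip: ennreal_plus)
  also have "(\<Sum>n. ennreal (q ^ n)) = ennreal (1 / (1 - q))"
    using assms by (intro suminf_ennreal_eq geometric_sums) auto
  also have "ennreal (1 / (1 - q)) * ennreal (2 * doubling_const\<^sup>2) = ennreal (2 * doubling_const\<^sup>2 / (1 - q))"
    using assms by (subst ennreal_mult[symmetric]) auto
  finally show ?thesis .
qed

text \<open>Off the diagonal the distance lies in one of the annuli, and the single summand for this
  annulus already dominates the left side. On the diagonal the left side vanishes, as
  \<open>0 powr t\<close> is 0.\<close>

lemma truncated_kernel_le_dyadic_kernel:
  assumes "0 < r" "0 < p" "p < t" and q: "q = 2 powr (- min p (t - p))"
  shows "ennreal (min 1 (dist x y / r) powr t / (dist x y powr p * measure M (ball x (dist x y))))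
    \<le> ennreal (r powr (- p)) * dyadic_kernel q r x y"
proof (cases "x = y")
  case False
  let ?d = "dist x y"
  have d: "0 < ?d" using False by simp
  \<comment> \<open>The index \<open>n\<close> counts dyadic steps from \<open>r\<close>, outwards
    if \<open>r \<le> dist x y\<close> and inwards otherwise; \<rho> is the inner radius of the
    annulus reached.\<close>
  have key: "\<exists>n \<rho>. (\<rho> = r * 2 ^ n \<or> \<rho> = r / 2 ^ Suc n) \<and> \<rho> \<le> ?d \<and> ?d \<le> 2 * \<rho>
      \<and> (2 ^ n \<le> ?d / r \<or> ?d / r \<le> 1 / 2 ^ n)"
  proof (cases "r \<le> ?d")
    case True
    then obtain n where "2 ^ n \<le> ?d / r" "?d / r \<le> 2 ^ Suc n"
      using ex_dyadic_interval[of "?d / r"] assms by auto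
    then show ?thesis
      using assms by (intro exI[of _ n] exI[of _ "r * 2 ^ n"]) (auto simp: field_simps)
  next
    case False
    then obtain n where "2 ^ n \<le> r / ?d" "r / ?d \<le> 2 ^ Suc n"
      using ex_dyadic_interval[of "r / ?d"] d by auto
    then show ?thesis
      using assms d by (intro exI[of _ n] exI[of _ "r / 2 ^ Suc n"]) (auto simp: field_simps)
  qed
  then obtain n \<rho> where \<rho>: "\<rho> = r * 2 ^ n \<or> \<rho> = r / 2 ^ Suc n" "\<rho> \<le> ?d" "?d \<le> 2 * \<rho>"
      and n: "2 ^ n \<le> ?d / r \<or> ?d / r \<le> 1 / 2 ^ n" by blast
  have "0 < \<rho>" using \<rho>(1) assms by auto
  then have pos: "0 < measure M (ball x \<rho>)" by (rule measure_ball_pos)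
  have le: "measure M (ball x \<rho>) \<le> measure M (ball x ?d)"
    using d \<rho> by (intro measure_mono_subset_ball[of _ _ x ?d]) auto
  \<comment> \<open>Taking out \<open>r powr (- p)\<close> leaves only the ratio
    \<open>?d / r\<close>, to which the geometric decay applies; passing to the smaller ball of
    radius \<rho> then only increases the quotient.\<close>
  have "min 1 (?d / r) powr t / (?d powr p * measure M (ball x ?d)) =
      r powr (- p) * (min 1 (?d / r) powr t * (?d / r) powr (- p)) / measure M (ball x ?d)"
    using d assms by (simp add: powr_divide powr_minus field_simps)
  also have "\<dots> \<le> r powr (- p) * q ^ n / measure M (ball x \<rho>)"
    unfolding q
    using truncated_ratio_powr_le[OF assms(2,3) _ n] d assms(1) le pos
    by (intro frac_le mult_left_mono) auto
  finally have "ennreal (min 1 (?d / r) powr t / (?d powr p * measure M (ball x ?d)))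
      \<le> ennreal (r powr (- p) * (q ^ n * (1 / measure M (ball x \<rho>))))"
    by (intro ennreal_leI) simp
  also have "\<dots> = ennreal (r powr (- p)) * (ennreal (q ^ n) * annulus_kernel \<rho> x y)"
  proof -
    have "indicator {\<rho>..2 * \<rho>} ?d = (1 :: real)"
      using \<rho> by simp
    then show ?thesis
      using pos q by (simp only: annulus_kernel_def ennreal_mult powr_ge_zero zero_le_power
          zero_le_mult_iff zero_le_divide_1_iff less_imp_le simp_thms)
  qed
  also have "\<dots> \<le> ennreal (r powr (- p)) * dyadic_kernel q r x y"
  proof (rule mult_left_mono)
    have "ennreal (q ^ n) * annulus_kernel \<rho> x y
        \<le> ennreal (q ^ n) * (annulus_kernel (r * 2 ^ n) x y + annulus_kernel (r / 2 ^ Suc n) x y)"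
      using \<rho>(1) by (intro mult_left_mono) auto
    also have "\<dots> \<le> dyadic_kernel q r x y"
      unfolding dyadic_kernel_def
      using sum_le_suminf[of "\<lambda>n. ennreal (q ^ n) * (annulus_kernel (r * 2 ^ n) x y + annulus_kernel (r / 2 ^ Suc n) x y)" "{n}"]
      by simp
    finally show "ennreal (q ^ n) * annulus_kernel \<rho> x y \<le> dyadic_kernel q r x y" .
  qed simp
  finally show ?thesis .
qed simp

section \<open>Energy of a truncated Lipschitz function\<close>

text \<open>Pairs with both points outside \<open>N\<close> contribute nothing. For pairs with
  \<open>x\<close> in \<open>N\<close> the kernel is integrated in \<open>y\<close>; for those with
  \<open>y\<close> in \<open>N\<close> the roles are exchanged at the cost of
  \<open>doubling_const\<close>. Each case yields the uniform mass of the dyadic kernel times the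
  measure of \<open>A \<inter> N\<close>.\<close>

lemma nn_integral_truncated_energy_le:
  fixes u :: "'a \<Rightarrow> real"
  assumes r: "0 < r" and p: "0 < p" "p < t"
    and q: "q = 2 powr (- min p (t - p))"
    and u: "\<And>x y. \<bar>u x - u y\<bar> \<le> min 1 (dist x y / r)"
    and const: "\<And>x y. x \<notin> N \<Longrightarrow> y \<notin> N \<Longrightarrow> u x = u y"
    and [measurable]: "A \<in> sets M" "N \<in> sets M"
  shows "(\<integral>\<^sup>+x\<in>A. (\<integral>\<^sup>+y\<in>A. ennreal (\<bar>u x - u y\<bar> powr t / (dist x y powr p * measure M (ball x (dist x y)))) \<partial>M) \<partial>M)
    \<le> ennreal (r powr (- p) * ((1 + doubling_const) * (2 * doubling_const\<^sup>2 / (1 - q)))) * emeasure M (A \<inter> N)"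
proof -
  interpret sigma_finite_measure M by (rule sigma_finite_measure_M)
  interpret pair_sigma_finite M M ..
  let ?F = "\<lambda>x y. ennreal (\<bar>u x - u y\<bar> powr t / (dist x y powr p * measure M (ball x (dist x y))))"
  let ?g = "\<lambda>x y. min 1 (dist x y / r) powr t / (dist x y powr p * measure M (ball x (dist x y)))"
  let ?K = "dyadic_kernel q r"
  let ?c = "ennreal doubling_const"
  let ?r = "ennreal (r powr (- p))"
  let ?I = "indicator (A \<inter> N) :: 'a \<Rightarrow> ennreal"
  have K_meas: "(\<lambda>y. ?K x y) \<in> borel_measurable M" "(\<lambda>y. ?K y x) \<in> borel_measurable M"
    "(\<lambda>z. ?K (fst z) (snd z)) \<in> borel_measurable (M \<Otimes>\<^sub>M M)"
    "(\<lambda>z. ?K (snd z) (fst z)) \<in> borel_measurable (M \<Otimes>\<^sub>M M)" for x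
    by (auto intro: borel_measurable_dyadic_kernel)
  note [measurable] = K_meas
  have swap_meas [measurable]: "(\<lambda>(x, y). ?I y * ?K y x) \<in> borel_measurable (M \<Otimes>\<^sub>M M)"
    unfolding case_prod_beta' by measurable
  have [measurable]: "(\<lambda>x. \<integral>\<^sup>+y. ?K x y \<partial>M) \<in> borel_measurable M"
    "(\<lambda>x. \<integral>\<^sup>+y. ?I y * ?K y x \<partial>M) \<in> borel_measurable M"
    using K_meas(3) swap_meas by (auto intro!: borel_measurable_nn_integral simp: case_prod_beta')
  define L where "L = 2 * doubling_const\<^sup>2 / (1 - q)"
  have q01: "0 < q" "q < 1"
    using p powr_less_mono[of "- min p (t - p)" 0 "2::real"] by (auto simp: q)
  have L0: "0 \<le> L" using q01 by (simp add: L_def)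
  have F_le: "?F x y \<le> ennreal (?g x y)" for x y
    using u p by (intro ennreal_leI divide_right_mono powr_mono2) auto
  have g_swap: "?g x y \<le> doubling_const * ?g y x" for x y
  proof (cases "x = y")
    case False
    then have d: "0 < dist x y" by simp
    have "1 / measure M (ball x (dist x y)) \<le> doubling_const / measure M (ball y (dist x y))"
      using measure_ball_swap[OF False] measure_ball_pos[OF d, of x] measure_ball_pos[OF d, of y]
      by (simp add: field_simps)
    then have "min 1 (dist x y / r) powr t / dist x y powr p * (1 / measure M (ball x (dist x y)))
      \<le> min 1 (dist x y / r) powr t / dist x y powr p * (doubling_const / measure M (ball y (dist x y)))"
      by (rule mult_left_mono) simp
    then show ?thesis by (simp add: dist_commute mult_ac)
  qed simp
  \<comment> \<open>Both alternatives are added, so that one bound covers all pairs in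
    \<open>A\<close>; the indicator stays on the point known to lie in \<open>N\<close>.\<close>
  have bound: "?F x y \<le> ?r * (?I x * ?K x y + ?c * (?I y * ?K y x))" if "x \<in> A" "y \<in> A" for x y
  proof -
    consider "x \<in> N" | "y \<in> N" | "x \<notin> N" "y \<notin> N" by blast
    then show ?thesis
    proof cases
      case 1
      have "?F x y \<le> ?r * ?K x y"
        using F_le truncated_kernel_le_dyadic_kernel[OF r p q] by (rule order_trans)
      also have "\<dots> \<le> ?r * (?I x * ?K x y + ?c * (?I y * ?K y x))"
        using 1 that by (intro mult_left_mono) auto
      finally show ?thesis .
    next
      case 2
      have "?F x y \<le> ennreal (doubling_const * ?g y x)"
        using F_le ennreal_leI[OF g_swap] by (rule order_trans)
      also have "\<dots> = ?c * ennreal (?g y x)"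
        using doubling_const_ge_1 by (intro ennreal_mult) auto
      also have "\<dots> \<le> ?c * (?r * ?K y x)"
        using truncated_kernel_le_dyadic_kernel[OF r p q] by (rule mult_left_mono) simp
      also have "\<dots> = ?r * (?c * (?I y * ?K y x))"
        using 2 that by (simp add: mult_ac)
      also have "\<dots> \<le> ?r * (?I x * ?K x y + ?c * (?I y * ?K y x))"
        by (intro mult_left_mono) auto
      finally show ?thesis .
    next
      case 3
      then have "u x = u y" by (rule const)
      then show ?thesis using p by simp
    qed
  qed
  \<comment> \<open>Only monotonicity of the integral is applied to the original integrand; the
    integrals on the right are of measurable dyadic kernels, with the point outside the indicator
    ranging over the whole space.\<close>
  have "(\<integral>\<^sup>+x\<in>A. (\<integral>\<^sup>+y\<in>A. ?F x y \<partial>M) \<partial>M)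
      \<le> (\<integral>\<^sup>+x. (\<integral>\<^sup>+y. ?r * (?I x * ?K x y + ?c * (?I y * ?K y x)) \<partial>M) \<partial>M)"
  proof (rule nn_integral_mono)
    fix x
    show "(\<integral>\<^sup>+y\<in>A. ?F x y \<partial>M) * indicator A x
        \<le> (\<integral>\<^sup>+y. ?r * (?I x * ?K x y + ?c * (?I y * ?K y x)) \<partial>M)"
    proof (cases "x \<in> A")
      case True
      have "?F x y * indicator A y \<le> ?r * (?I x * ?K x y + ?c * (?I y * ?K y x))" for y
        using bound[OF True, of y] by (cases "y \<in> A") auto
      then show ?thesis using True by (auto intro: nn_integral_mono)
    qed simp
  qed
  also have "\<dots> = ?r * ((\<integral>\<^sup>+x. ?I x * (\<integral>\<^sup>+y. ?K x y \<partial>M) \<partial>M)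
      + ?c * (\<integral>\<^sup>+x. (\<integral>\<^sup>+y. ?I y * ?K y x \<partial>M) \<partial>M))"
    by (simp add: nn_integral_cmult nn_integral_add)
  \<comment> \<open>After Tonelli the second term is the first with its variables renamed, whence
    the factor \<open>1 + ?c\<close>.\<close>
  also have "(\<integral>\<^sup>+x. (\<integral>\<^sup>+y. ?I y * ?K y x \<partial>M) \<partial>M) = (\<integral>\<^sup>+y. (\<integral>\<^sup>+x. ?I y * ?K y x \<partial>M) \<partial>M)"
    by (rule Fubini') (use swap_meas in \<open>simp add: case_prod_beta'\<close>)
  also have "\<dots> = (\<integral>\<^sup>+y. ?I y * (\<integral>\<^sup>+x. ?K y x \<partial>M) \<partial>M)"
    by (simp add: nn_integral_cmult)
  also have "?r * ((\<integral>\<^sup>+x. ?I x * (\<integral>\<^sup>+y. ?K x y \<partial>M) \<partial>M) + ?c * (\<integral>\<^sup>+y. ?I y * (\<integral>\<^sup>+x. ?K y x \<partial>M) \<partial>M))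
      = ?r * (1 + ?c) * (\<integral>\<^sup>+x. ?I x * (\<integral>\<^sup>+y. ?K x y \<partial>M) \<partial>M)"
    by (simp add: algebra_simps)
  also have "\<dots> \<le> ?r * (1 + ?c) * (\<integral>\<^sup>+x. ennreal L * ?I x \<partial>M)"
    using nn_integral_dyadic_kernel_le[OF r q01]
    by (intro mult_left_mono nn_integral_mono) (auto simp: L_def indicator_def)
  also have "\<dots> = ?r * (1 + ?c) * ennreal L * emeasure M (A \<inter> N)"
    by (subst nn_integral_cmult_indicator) (auto simp: mult_ac)
  also have "?r * (1 + ?c) * ennreal L = ennreal (r powr (- p) * ((1 + doubling_const) * L))"
    using L0 doubling_const_ge_1
    by (simp add: ennreal_mult mult.assoc flip: ennreal_1 ennreal_plus)
  finally show ?thesis by (simp only: L_def)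
qed

end

section \<open>From the Hardy inequality to the codimension bound\<close>

theorem theorem5p3:
  fixes M :: "'a::metric_space measure"
    and s t \<Lambda> C :: real
    and E :: "'a set"
  assumes "doubling_metric_measure_space M"
    and "0 < s" and "s < 1" and "1 < t" and "\<Lambda> \<ge> 1"
    and "closed E" and "E \<noteq> {}"
    and "C > 0"
    and hardy: "\<And>(u :: 'a \<Rightarrow> real) w r.
      \<lbrakk>continuous_on UNIV u; bounded (range u); \<forall>x\<in>E. u x = 0; w \<in> E; admissible_radius E r\<rbrakk> \<Longrightarrow>
      (\<integral>\<^sup>+x\<in>ball w r - E. ennreal (\<bar>u x\<bar> powr t / infdist x E powr (s * t)) \<partial>M)
      \<le> ennreal C *
        (\<integral>\<^sup>+x\<in>ball w (\<Lambda> * r). (\<integral>\<^sup>+y\<in>ball w (\<Lambda> * r).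
           ennreal (\<bar>u x - u y\<bar> powr t /
             (dist x y powr (s * t) * measure M (ball x (dist x y)))) \<partial>M) \<partial>M)"
  shows "upper_assouad_codim M E \<le> ereal (s * t)"
proof -
  interpret doubling_metric_measure_space M by fact
  define p where "p = s * t"
  have p: "0 < p" "p < t"
    using assms by (auto simp: p_def)
  define q where "q = 2 powr (- min p (t - p))"
  have "q < 1"
    using p powr_less_mono[of "- min p (t - p)" 0 "2::real"] by (auto simp: q_def)
  define K where "K = (1 + doubling_const) * (2 * doubling_const\<^sup>2 / (1 - q))"
  have K0: "0 \<le> K"
    using \<open>q < 1\<close> doubling_const_ge_1 by (auto simp: K_def)
  \<comment> \<open>\<open>n\<close> doublings pass from the ball of radius
    \<open>R / \<Lambda>\<close> to one containing the ball of radius \<open>R\<close>.\<close>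
  obtain n where n: "\<Lambda> < 2 ^ n"
    using real_arch_pow[of 2 \<Lambda>] by auto
  define D where "D = doubling_const ^ n"
  have D: "1 \<le> D"
    unfolding D_def using doubling_const_ge_1 by (rule one_le_power)
  \<comment> \<open>The factor 2 comes from splitting the small ball along the neighbourhood of
    \<open>E\<close>, \<open>D\<close> from returning to the large ball, and the maximum covers both
    pieces: \<open>C * K\<close> the outer one, 1 the inner one.\<close>
  define c where "c = 1 / (2 * D * max 1 (C * K))"
  have "0 < c"
    using D by (auto simp: c_def)
  have "c * (r / R) powr p \<le> measure M (open_nbhd E r \<inter> ball w R) / measure M (ball w R)"
    if w: "w \<in> E" and r: "0 < r" "r < R" and R: "admissible_radius E R" for w r R
  proof -
    \<comment> \<open>With this radius the dilated ball on the right of the Hardy inequality is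
      exactly \<open>ball w R\<close>; admissibility passes to smaller positive radii.\<close>
    define R' where "R' = R / \<Lambda>"
    have R': "0 < R'" "R' \<le> R" "\<Lambda> * R' = R"
      using r \<open>\<Lambda> \<ge> 1\<close> by (auto simp: R'_def field_simps)
    have adm: "admissible_radius E R'"
      using R R' unfolding admissible_radius_def by (metis ereal_less_eq(3) order_le_less_trans)
    define N where "N = open_nbhd E r"
    have "open N"
      unfolding N_def open_nbhd_def by (intro open_Collect_less continuous_intros)
    then have N [measurable]: "N \<in> sets borel" by simp
    define b where "b = measure M (N \<inter> ball w R)"
    have b0: "0 \<le> b" by (simp add: b_def)
    define u where "u x = min 1 (infdist x E / r)" for x
    have u_cont: "continuous_on UNIV u"
      unfolding u_def using r by (intro continuous_intros) auto
    have u01: "0 \<le> u x" "u x \<le> 1" for x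
      using r by (auto simp: u_def infdist_nonneg)
    have "bounded (range u)"
      using u01 by (intro boundedI[of _ 1]) auto
    moreover have "\<forall>x\<in>E. u x = 0"
      by (simp add: u_def)
    moreover have u_out: "u x = 1" if "x \<notin> N" for x
      using that r by (auto simp: u_def N_def open_nbhd_def min_def)
    moreover have u_lip: "\<bar>u x - u y\<bar> \<le> min 1 (dist x y / r)" for x y
    proof -
      have "\<bar>infdist x E / r - infdist y E / r\<bar> \<le> dist x y / r"
        using infdist_triangle[of x E y] infdist_triangle[of y E x] r
        by (auto simp: abs_le_iff dist_commute field_simps)
      then have "\<bar>u x - u y\<bar> \<le> dist x y / r"
        unfolding u_def by linarith
      then show ?thesis using u01[of x] u01[of y] by auto
    qed
    ultimately have "(\<integral>\<^sup>+x\<in>ball w R' - E. ennreal (\<bar>u x\<bar> powr t / infdist x E powr p) \<partial>M)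
      \<le> ennreal C * (\<integral>\<^sup>+x\<in>ball w R. (\<integral>\<^sup>+y\<in>ball w R.
           ennreal (\<bar>u x - u y\<bar> powr t / (dist x y powr p * measure M (ball x (dist x y)))) \<partial>M) \<partial>M)"
      using hardy[OF u_cont _ _ w adm] by (simp add: R' p_def)
    also have "\<dots> \<le> ennreal C * (ennreal (r powr (- p) * K) * emeasure M (ball w R \<inter> N))"
      unfolding K_def
      using r u_out u_lip by (intro mult_left_mono nn_integral_truncated_energy_le[OF _ p q_def]) (auto simp: sets_M)
    also have "emeasure M (ball w R \<inter> N) = ennreal b"
      using r N emeasure_subset_ball_eq_measure[of "ball w R \<inter> N" w R] by (auto simp: b_def Int_commute)
    also have "ennreal C * (ennreal (r powr (- p) * K) * ennreal b) = ennreal (C * (r powr (- p) * K * b))"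
      using \<open>C > 0\<close> K0 b0 by (simp add: ennreal_mult)
    finally have upper: "(\<integral>\<^sup>+x\<in>ball w R' - E. ennreal (\<bar>u x\<bar> powr t / infdist x E powr p) \<partial>M)
      \<le> ennreal (C * (r powr (- p) * K * b))" .
    have "ennreal (R' powr (- p) * measure M (ball w R' - N))
        = (\<integral>\<^sup>+x. ennreal (R' powr (- p)) * indicator (ball w R' - N) x \<partial>M)"
      using R' N emeasure_subset_ball_eq_measure[of "ball w R' - N" w R']
      by (subst nn_integral_cmult_indicator) (auto simp: sets_M ennreal_mult)
    also have "\<dots> \<le> (\<integral>\<^sup>+x\<in>ball w R' - E. ennreal (\<bar>u x\<bar> powr t / infdist x E powr p) \<partial>M)"
    proof (rule nn_integral_mono)
      fix x
      show "ennreal (R' powr (- p)) * indicator (ball w R' - N) x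
          \<le> ennreal (\<bar>u x\<bar> powr t / infdist x E powr p) * indicator (ball w R' - E) x"
      proof (cases "x \<in> ball w R' - N")
        case True
        then have "r \<le> infdist x E"
          by (auto simp: N_def open_nbhd_def)
        then have pos: "0 < infdist x E" and "x \<notin> E"
          using r by auto
        \<comment> \<open>The centre \<open>w\<close> belongs to \<open>E\<close>, so the distance
          to \<open>E\<close> is at most the distance to \<open>w\<close>; the weight is therefore
          at least \<open>R' powr (- p)\<close>.\<close>
        have "infdist x E \<le> R'"
          using True infdist_le[OF w, of x] by (auto simp: dist_commute)
        then have "R' powr (- p) \<le> infdist x E powr (- p)"
          using pos p by (intro powr_mono2') auto
        then show ?thesis
          using True \<open>x \<notin> E\<close> u_out[of x] by (auto simp: powr_minus_divide intro: ennreal_leI)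
      qed simp
    qed
    also note upper
    finally have "R' powr (- p) * measure M (ball w R' - N) \<le> C * (r powr (- p) * K * b)"
      using \<open>C > 0\<close> K0 b0 by (subst (asm) ennreal_le_iff) auto
    then have "measure M (ball w R' - N) \<le> C * K * ((R' / r) powr p * b)"
      using R' r by (simp add: powr_divide powr_minus_divide field_simps)
    also have "\<dots> \<le> max 1 (C * K) * ((R / r) powr p * b)"
      using R' r p b0 \<open>C > 0\<close> K0 by (intro mult_mono powr_mono2 divide_right_mono) auto
    finally have out: "measure M (ball w R' - N) \<le> max 1 (C * K) * ((R / r) powr p * b)" .
    \<comment> \<open>The inner piece is part of the set measured by \<open>b\<close>; since
      \<open>R / r > 1\<close>, it obeys the same bound as the outer piece.\<close>
    have "measure M (ball w R' \<inter> N) \<le> b"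
      unfolding b_def using subset_ball[OF R'(2), of w] r
      by (intro measure_mono_subset_ball[of _ _ w R]) auto
    also have "\<dots> \<le> max 1 (C * K) * ((R / r) powr p * b)"
    proof -
      have "1 \<le> (R / r) powr p"
        using r p by (intro ge_one_powr_ge_zero) auto
      then have "1 * (1 * b) \<le> max 1 (C * K) * ((R / r) powr p * b)"
        using b0 by (intro mult_mono) auto
      then show ?thesis by simp
    qed
    finally have inn: "measure M (ball w R' \<inter> N) \<le> max 1 (C * K) * ((R / r) powr p * b)" .
    have "measure M (ball w R) \<le> measure M (ball w (2 ^ n * R'))"
    proof (rule measure_mono_subset_ball[of _ _ w "2 ^ n * R'"])
      have "\<Lambda> * R' \<le> 2 ^ n * R'"
        using n R'(1) by (intro mult_right_mono) auto
      then show "ball w R \<subseteq> ball w (2 ^ n * R')"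
        unfolding R'(3) by (rule subset_ball)
    qed (use R'(1) in auto)
    also have "\<dots> \<le> D * measure M (ball w R')"
      unfolding D_def using R' by (intro measure_ball_power2)
    \<comment> \<open>Additivity is taken from the extended-valued measure and transferred to real
      values by finiteness on the ball.\<close>
    also have "measure M (ball w R') = measure M (ball w R' - N) + measure M (ball w R' \<inter> N)"
    proof -
      have "(ball w R' - N) \<union> (ball w R' \<inter> N) = ball w R'"
        "(ball w R' - N) \<inter> (ball w R' \<inter> N) = {}" by blast+
      then have "emeasure M (ball w R') = emeasure M (ball w R' - N) + emeasure M (ball w R' \<inter> N)"
        using plus_emeasure[of "ball w R' - N" M "ball w R' \<inter> N"] N by (auto simp: sets_M)
      moreover have "emeasure M S = ennreal (measure M S)" if "S \<in> sets borel" "S \<subseteq> ball w R'" for S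
        using emeasure_subset_ball_eq_measure[OF that(2) R'(1) that(1)] .
      ultimately have "ennreal (measure M (ball w R'))
          = ennreal (measure M (ball w R' - N)) + ennreal (measure M (ball w R' \<inter> N))"
        using N by simp
      then show ?thesis
        by (metis ennreal_inj ennreal_plus measure_nonneg add_nonneg_nonneg)
    qed
    also have "D * \<dots> \<le> D * (2 * (max 1 (C * K) * ((R / r) powr p * b)))"
      using out inn D by (intro mult_left_mono) auto
    also have "\<dots> = (R / r) powr p * b / c"
      by (simp add: c_def)
    finally have "c * measure M (ball w R) \<le> (R / r) powr p * b"
      using \<open>0 < c\<close> by (simp add: field_simps)
    \<comment> \<open>The powers of \<open>r / R\<close> and \<open>R / r\<close> cancel, which
      turns the estimate into the required lower bound for \<open>b\<close>.\<close>
    then have "(r / R) powr p * (c * measure M (ball w R)) \<le> (r / R) powr p * ((R / r) powr p * b)"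
      by (rule mult_left_mono) simp
    also have "\<dots> = ((r / R) * (R / r)) powr p * b"
      by (simp only: powr_mult mult.assoc)
    also have "\<dots> = b"
      using r by simp
    finally show ?thesis
      using measure_ball_pos[of R w] r by (simp add: pos_le_divide_eq b_def N_def mult_ac)
  qed
  \<comment> \<open>The constant \<open>c\<close> was fixed before \<open>w\<close>,
    \<open>r\<close> and \<open>R\<close>, so it is uniform and \<open>p\<close> belongs to the set
    whose infimum is the codimension.\<close>
  then have "ereal p \<in> ereal ` {Q. Q \<ge> 0 \<and>
       (\<exists>c>0. \<forall>x\<in>E. \<forall>r R. 0 < r \<and> r < R \<and> admissible_radius E R \<longrightarrow>
          measure M (open_nbhd E r \<inter> ball x R) / measure M (ball x R) \<ge> c * (r / R) powr Q)}"
    using \<open>0 < c\<close> p by (intro imageI CollectI conjI exI[of _ c]) auto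
  then show ?thesis
    unfolding upper_assouad_codim_def p_def by (rule Inf_lower)
qed

end
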